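(* Let $\alpha\in(0,1)$, $\theta>0$, $\lambda_1,\lambda_2>0$, and let $\{\mathcal Q^{\alpha,\theta}(t)\}_{t\ge0}$ be the bivariate tempered space-fractional Poisson process with these parameters. For $\mathbf k=(k_1,k_2)$ with $k_1,k_2\in\{0,1,2,\dots\}$, the probability mass function $q^{\alpha,\theta}(\mathbf k,t)=\mathbb P\{\mathcal Q^{\alpha,\theta}(t)=\mathbf k\}$ is given by $$q^{\alpha,\theta}(\mathbf k,t)=\Big(-\frac1{\lambda_1+\lambda_2}\Big)^{k_1+k_2}\frac{\lambda_1^{k_1}\lambda_2^{k_2}}{k_1!\,k_2!}\,e^{t\theta^\alpha}\sum_{i=0}^\infty\frac{\theta^i}{i!\,(\lambda_1+\lambda_2)^i}\;{}_1\psi_1\!\left[-(\lambda_1+\lambda_2)^\alpha t\ \Big|\ \begin{matrix}(1,\alpha)\\(1-(k_1+k_2)-i,\alpha)\end{matrix}\right].$$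
   Context: The tempered $\alpha$-stable subordinator $\{S^{\alpha,\theta}(t)\}_{t\ge0}$ is the Lévy subordinator with $\mathbb E[e^{-uS^{\alpha,\theta}(t)}]=e^{-t((u+\theta)^\alpha-\theta^\alpha)}$, $u\ge0$. Let $\{\mathcal N_i(t,\lambda_i)\}_{t\ge0}$, $i=1,2$, be independent homogeneous Poisson processes with rates $\lambda_i$, independent of $S^{\alpha,\theta}$. The bivariate tempered space-fractional Poisson process is $\mathcal Q^{\alpha,\theta}(t)=(\mathcal N_1(S^{\alpha,\theta}(t),\lambda_1),\mathcal N_2(S^{\alpha,\theta}(t),\lambda_2))$. The generalized Wright function used here is ${}_1\psi_1\!\left[z\,\Big|\,\begin{matrix}(a,b)\\(c,d)\end{matrix}\right]=\sum_{m=0}^\infty\frac{z^m}{m!}\frac{\Gamma(a+bm)}{\Gamma(c+dm)}$ (under the convergence condition $d-b>-1$), with the usual convention $1/\Gamma(x)=0$ for $x\in\{0,-1,-2,\dots\}$.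
   Formalization: The formula is proved whenever the outer series over i converges, and convergence is proved for θ < λ1+λ2; for θ > λ1+λ2 and t > 0 that series diverges, so the claim as printed has no meaning there. Path conditions (càdlàg, nondecreasing) are taken at every sample point. *)

theory Defs
  imports "HOL-Probability.Probability"
begin

text \<open>
  Processes are functions of type \<open>real \<Rightarrow> 'a \<Rightarrow> _\<close>; only the times \<open>t \<ge> 0\<close> are constrained.
  The path conditions are imposed on every sample point, so that evaluating one process
  at the random time given by another yields measurable events even if \<open>M\<close> is not complete.
\<close>

definition independent_increments :: "'a measure \<Rightarrow> (real \<Rightarrow> 'a \<Rightarrow> real) \<Rightarrow> bool" where
  "independent_increments M X \<longleftrightarrow>
     (\<forall>(n::nat) (\<tau>::nat \<Rightarrow> real). 0 \<le> \<tau> 0 \<and> (\<forall>i<n. \<tau> i \<le> \<tau> (Suc i)) \<longrightarrow>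
        prob_space.indep_vars M (\<lambda>_. borel) (\<lambda>i \<omega>. X (\<tau> (Suc i)) \<omega> - X (\<tau> i) \<omega>) {..<n})"

definition stationary_increments :: "'a measure \<Rightarrow> (real \<Rightarrow> 'a \<Rightarrow> real) \<Rightarrow> bool" where
  "stationary_increments M X \<longleftrightarrow>
     (\<forall>s\<ge>0. \<forall>h\<ge>0. distr M borel (\<lambda>\<omega>. X (s + h) \<omega> - X s \<omega>) = distr M borel (\<lambda>\<omega>. X h \<omega> - X 0 \<omega>))"

definition cadlag_path :: "(real \<Rightarrow> real) \<Rightarrow> bool" where
  "cadlag_path x \<longleftrightarrow> (\<forall>t\<ge>0. continuous (at_right t) x) \<and> (\<forall>t>0. \<exists>l. (x \<longlongrightarrow> l) (at_left t))"

definition levy_process :: "'a measure \<Rightarrow> (real \<Rightarrow> 'a \<Rightarrow> real) \<Rightarrow> bool" where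
  "levy_process M X \<longleftrightarrow>
     (\<forall>t\<ge>0. X t \<in> borel_measurable M) \<and>
     (AE \<omega> in M. X 0 \<omega> = 0) \<and>
     independent_increments M X \<and>
     stationary_increments M X \<and>
     (\<forall>\<omega>\<in>space M. cadlag_path (\<lambda>t. X t \<omega>))"

definition levy_subordinator :: "'a measure \<Rightarrow> (real \<Rightarrow> 'a \<Rightarrow> real) \<Rightarrow> bool" where
  "levy_subordinator M X \<longleftrightarrow> levy_process M X \<and>
     (\<forall>\<omega>\<in>space M. \<forall>s\<ge>0. \<forall>t\<ge>s. 0 \<le> X s \<omega> \<and> X s \<omega> \<le> X t \<omega>)"

definition tempered_stable_subordinator ::
    "'a measure \<Rightarrow> real \<Rightarrow> real \<Rightarrow> (real \<Rightarrow> 'a \<Rightarrow> real) \<Rightarrow> bool" where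
  "tempered_stable_subordinator M \<alpha> \<theta> S \<longleftrightarrow> levy_subordinator M S \<and>
     (\<forall>t\<ge>0. \<forall>u\<ge>0. integral\<^sup>L M (\<lambda>\<omega>. exp (- u * S t \<omega>)) =
        exp (- t * ((u + \<theta>) powr \<alpha> - \<theta> powr \<alpha>)))"

text \<open>The library's \<open>poisson_pmf\<close> is specified only for positive rate, hence the restriction to
  \<open>t > 0\<close> in the marginal law; at time 0 the process vanishes almost surely.\<close>

definition poisson_process :: "'a measure \<Rightarrow> real \<Rightarrow> (real \<Rightarrow> 'a \<Rightarrow> nat) \<Rightarrow> bool" where
  "poisson_process M r N \<longleftrightarrow> levy_process M (\<lambda>t \<omega>. real (N t \<omega>)) \<and>
     (\<forall>t>0. distr M (count_space UNIV) (N t) = measure_pmf (poisson_pmf (r * t)))"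

definition process_events :: "'a measure \<Rightarrow> (real \<Rightarrow> 'a \<Rightarrow> real) \<Rightarrow> 'a set set" where
  "process_events M X =
     sigma_sets (space M) {X t -` A \<inter> space M | t A. 0 \<le> t \<and> A \<in> sets borel}"

definition independent_processes :: "'a measure \<Rightarrow> (real \<Rightarrow> 'a \<Rightarrow> real) list \<Rightarrow> bool" where
  "independent_processes M Xs \<longleftrightarrow>
     prob_space.indep_sets M (\<lambda>j. process_events M (Xs ! j)) {..<length Xs}"

definition bivariate_subordinated ::
    "(real \<Rightarrow> 'a \<Rightarrow> nat) \<Rightarrow> (real \<Rightarrow> 'a \<Rightarrow> nat) \<Rightarrow> (real \<Rightarrow> 'a \<Rightarrow> real) \<Rightarrow> real \<Rightarrow> 'a \<Rightarrow> nat \<times> nat" where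
  "bivariate_subordinated N1 N2 S t \<omega> = (N1 (S t \<omega>) \<omega>, N2 (S t \<omega>) \<omega>)"

text \<open>\<open>rGamma\<close> is the entire function \<open>1 / \<Gamma>\<close>, which vanishes at \<open>0, -1, -2, \<dots>\<close>.\<close>

definition wright_1psi1 :: "real \<Rightarrow> real \<times> real \<Rightarrow> real \<times> real \<Rightarrow> real" where
  "wright_1psi1 z = (\<lambda>(a, b) (c, d).
     \<Sum>m. z ^ m / fact m * (Gamma (a + b * real m) * rGamma (c + d * real m)))"

end

theory Submission
  imports Defs "HOL-Complex_Analysis.Complex_Analysis"
begin

text \<open>
  Write \<open>L = l1 + l2\<close>, \<open>k = k1 + k2\<close> and \<open>g w = exp (- t * w powr \<alpha>)\<close>. Conditioning on \<open>S t\<close> reduces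
  the probability to the moment \<open>E (S t ^ k * exp (- L * S t))\<close>, which is, up to sign and the
  factor \<open>exp (t * \<theta> powr \<alpha>)\<close>, the \<open>k\<close>-th derivative of \<open>g\<close> at \<open>L + \<theta>\<close>. Differentiating the
  exponential series of \<open>g\<close> termwise yields the Wright functions, so the series in the theorem
  is \<open>L ^ k\<close> times the Taylor series of that derivative around \<open>L\<close>, evaluated at \<open>L + \<theta>\<close>. Its
  disc of convergence only reaches the branch point \<open>0\<close>, so for \<open>\<theta> \<ge> L\<close> a convergent sum is
  identified by analytic continuation in the right half-plane and Abel's limit theorem.
\<close>

section \<open>Power series\<close>

text \<open>Summation by parts turns the distance to \<open>suminf a\<close> into
  \<open>1 - x\<close> times the power series of the partial sum errors \<open>s\<close>. Since
  \<open>s\<close> tends to 0, its tail contributes at most \<open>e / 2\<close>, and its finite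
  head vanishes with the factor \<open>1 - x\<close>.\<close>

lemma abel_limit:
  fixes a :: "nat \<Rightarrow> 'a::{real_normed_field,banach}"
  assumes "summable a"
  shows "((\<lambda>x. \<Sum>n. a n * of_real x ^ n) \<longlongrightarrow> suminf a) (at_left 1)"
proof -
  define s where "s = (\<lambda>n. (\<Sum>i\<le>n. a i) - suminf a)"
  have s0: "s \<longlonglongrightarrow> 0"
    using summable_LIMSEQ'[OF assms] unfolding s_def by (simp add: LIM_zero)
  have ident: "(\<lambda>n. s n * of_real x ^ n) sums
      (((\<Sum>n. a n * of_real x ^ n) - suminf a) / (1 - of_real x))"
    if x: "\<bar>x\<bar> < 1" for x
  proof -
    have geo: "(\<lambda>n. (of_real x :: 'a) ^ n) sums (1 / (1 - of_real x))"
      by (rule geometric_sums) (use x in simp)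
    have "summable (\<lambda>n. norm (a n * of_real x ^ n))"
      by (rule powser_insidea[where x = 1]) (use assms x in auto)
    \<comment> \<open>The Cauchy product with the geometric series replaces the coefficients by
      their partial sums.\<close>
    then have "(\<lambda>n. \<Sum>i\<le>n. (a i * of_real x ^ i) * of_real x ^ (n - i)) sums
        ((\<Sum>n. a n * of_real x ^ n) * (\<Sum>n. of_real x ^ n))"
      by (rule Cauchy_product_sums) (use x in \<open>simp add: norm_power summable_geometric\<close>)
    also have "(\<lambda>n. \<Sum>i\<le>n. (a i * of_real x ^ i) * of_real x ^ (n - i)) =
        (\<lambda>n. (\<Sum>i\<le>n. a i) * of_real x ^ n)"
      by (auto simp: fun_eq_iff sum_distrib_right mult.assoc simp flip: power_add)
    finally have "(\<lambda>n. (\<Sum>i\<le>n. a i) * of_real x ^ n) sums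
        ((\<Sum>n. a n * of_real x ^ n) * (1 / (1 - of_real x)))"
      using sums_unique[OF geo] by simp
    from sums_diff[OF this sums_mult[OF geo, of "suminf a"]] show ?thesis
      by (simp add: s_def left_diff_distrib diff_divide_distrib)
  qed
  show ?thesis
  proof (rule tendstoI)
    fix e :: real assume e: "e > 0"
    obtain N where N: "\<And>n. n \<ge> N \<Longrightarrow> norm (s n) < e / 2"
      using LIMSEQ_D[OF s0, of "e / 2"] e by auto
    define K where "K = (\<Sum>n<N. norm (s n))"
    have K: "K \<ge> 0" by (simp add: K_def sum_nonneg)
    \<comment> \<open>The threshold forces \<open>(1 - x) * K < e / 2\<close>; using
      \<open>K + 1\<close> avoids a division by zero when \<open>K = 0\<close>.\<close>
    have bound: "dist (\<Sum>n. a n * of_real x ^ n) (suminf a) < e"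
      if x: "x < 1" "x > 0" "x > 1 - e / (2 * (K + 1))" for x
    proof -
      have x1: "\<bar>x\<bar> < 1" using x by simp
      let ?d = "\<lambda>n. (if n < N then norm (s n) else 0) + e / 2 * x ^ n"
      have "(\<lambda>n. if n \<in> {..<N} then norm (s n) else 0) sums K"
        unfolding K_def by (rule sums_If_finite_set) simp
      then have d: "?d sums (K + e / 2 * (1 / (1 - x)))"
        by (intro sums_add sums_mult geometric_sums) (use x1 in simp_all)
      have le: "norm (s n * of_real x ^ n) \<le> ?d n" for n
      proof (cases "n < N")
        case True
        have "norm (s n) * x ^ n \<le> norm (s n) * 1"
          using x by (intro mult_left_mono power_le_one) auto
        moreover have "0 \<le> e / 2 * x ^ n" using x e by simp
        ultimately show ?thesis using True x by (simp add: norm_mult norm_power)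
      next
        case False
        then have "norm (s n) * x ^ n \<le> e / 2 * x ^ n"
          using x N[of n] by (intro mult_right_mono) auto
        then show ?thesis using False x by (simp add: norm_mult norm_power)
      qed
      have "norm (\<Sum>n. s n * of_real x ^ n) \<le> (\<Sum>n. ?d n)"
        by (rule norm_suminf_le[OF le sums_summable[OF d]])
      then have "norm (((\<Sum>n. a n * of_real x ^ n) - suminf a) / (1 - of_real x))
          \<le> K + e / 2 * (1 / (1 - x))"
        using ident[OF x1] d by (simp add: sums_iff)
      moreover have "norm (1 - of_real x :: 'a) = 1 - x"
        using x by (metis abs_of_pos diff_gt_0_iff_gt norm_of_real of_real_1 of_real_diff)
      ultimately have "norm ((\<Sum>n. a n * of_real x ^ n) - suminf a)
          \<le> (K + e / 2 * (1 / (1 - x))) * (1 - x)"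
        using x by (simp add: norm_divide pos_divide_le_eq)
      also have "\<dots> = (1 - x) * K + e / 2"
        using x by (simp add: field_simps)
      finally have "norm ((\<Sum>n. a n * of_real x ^ n) - suminf a) \<le> (1 - x) * K + e / 2" .
      moreover have "(1 - x) * K < e / 2"
      proof -
        have "(1 - x) * K \<le> (1 - x) * (K + 1)"
          using x by (intro mult_left_mono) auto
        also have "\<dots> < e / (2 * (K + 1)) * (K + 1)"
          using x K by (intro mult_strict_right_mono) auto
        also have "\<dots> = e / 2" using K by (simp add: field_simps)
        finally show ?thesis .
      qed
      ultimately show ?thesis by (simp add: dist_norm)
    qed
    show "\<forall>\<^sub>F x in at_left 1. dist (\<Sum>n. a n * of_real x ^ n) (suminf a) < e"
      unfolding eventually_at_left_field
      by (rule exI[of _ "max 0 (1 - e / (2 * (K + 1)))"])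
         (use e K bound in auto)
  qed
qed

text \<open>Convergence at \<open>w\<close> gives convergence in the open ball around
  \<open>z\<close> with \<open>w\<close> on its boundary, even if that ball leaves \<open>U\<close>.
  The sum agrees with \<open>f\<close> near \<open>z\<close>, hence on the part of the ball inside
  \<open>U\<close> by the identity theorem, and Abel summation along the segment from
  \<open>z\<close> to \<open>w\<close> reaches \<open>w\<close> itself.\<close>

lemma taylor_sum_eq_if_summable:
  fixes f :: "complex \<Rightarrow> complex"
  assumes "open U" "convex U" "z \<in> U" "w \<in> U" and holo: "f holomorphic_on U"
    and summable: "summable (\<lambda>n. (deriv ^^ n) f z / fact n * (w - z) ^ n)"
  shows "(\<lambda>n. (deriv ^^ n) f z / fact n * (w - z) ^ n) sums f w"
proof (cases "w = z")
  case True
  have "(\<lambda>n. (deriv ^^ n) f z / fact n * 0 ^ n) sums f z"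
    by (subst powser_sums_zero_iff) simp
  then show ?thesis using True by simp
next
  case False
  define c where "c = (\<lambda>n. (deriv ^^ n) f z / fact n)"
  define r where "r = norm (w - z)"
  have r: "r > 0" using False by (simp add: r_def)
  define P where "P = (\<lambda>u. \<Sum>n. c n * (u - z) ^ n)"
  have P: "(\<lambda>n. c n * (u - z) ^ n) sums P u" if "u \<in> ball z r" for u
    unfolding P_def
    by (rule summable_sums, rule powser_inside[where x = "w - z"])
       (use that summable in \<open>auto simp: c_def r_def dist_norm norm_minus_commute\<close>)
  have holP: "P holomorphic_on ball z r"
    by (rule power_series_holomorphic) (rule P)
  obtain d where d: "d > 0" "ball z d \<subseteq> ball z r \<inter> U"
    using openE[of "ball z r \<inter> U" z] assms r by auto
  \<comment> \<open>An intersection of convex sets is convex, which supplies the connectedness that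
    the identity theorem needs.\<close>
  have eq: "P u = f u" if "u \<in> ball z r \<inter> U" for u
  proof (rule analytic_continuation_open[where f = P and g = f and s = "ball z d" and s' = "ball z r \<inter> U"])
    show "connected (ball z r \<inter> U)"
      using assms by (intro convex_connected convex_Int) auto
    show "P holomorphic_on ball z r \<inter> U" "f holomorphic_on ball z r \<inter> U"
      using holP holo by (auto intro: holomorphic_on_subset)
    show "P v = f v" if "v \<in> ball z d" for v
    proof -
      have "(\<lambda>n. c n * (v - z) ^ n) sums f v"
        unfolding c_def using holo d that
        by (intro holomorphic_power_series[where r = d]) (auto intro: holomorphic_on_subset)
      then show ?thesis by (simp add: P_def sums_iff)
    qed
  qed (use d that assms in auto)
  \<comment> \<open>The segment from \<open>z\<close> to \<open>w\<close>: for
    \<open>0 < x < 1\<close> it lies in the open ball, and in \<open>U\<close> by convexity.\<close>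
  define \<gamma> where "\<gamma> = (\<lambda>x::real. z + of_real x * (w - z))"
  have "((\<lambda>x. \<Sum>n. c n * (w - z) ^ n * of_real x ^ n) \<longlongrightarrow> (\<Sum>n. c n * (w - z) ^ n)) (at_left 1)"
    using summable by (intro abel_limit) (simp add: c_def)
  moreover have "\<forall>\<^sub>F x in at_left 1. (\<Sum>n. c n * (w - z) ^ n * of_real x ^ n) = f (\<gamma> x)"
    unfolding eventually_at_left_field
  proof (intro exI[of _ 0] conjI allI impI)
    fix x :: real assume x: "0 < x" "x < 1"
    have "dist z (\<gamma> x) = x * r"
      using x by (simp add: \<gamma>_def r_def dist_norm norm_mult)
    moreover have "\<gamma> x = (1 - x) *\<^sub>R z + x *\<^sub>R w"
      by (simp add: \<gamma>_def scaleR_conv_of_real algebra_simps)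
    then have "\<gamma> x \<in> U"
      using x assms convexD[of U z w "1 - x" x] by simp
    ultimately have "P (\<gamma> x) = f (\<gamma> x)"
      using x r by (intro eq) auto
    then show "(\<Sum>n. c n * (w - z) ^ n * of_real x ^ n) = f (\<gamma> x)"
      by (simp add: P_def \<gamma>_def power_mult_distrib mult_ac)
  qed auto
  ultimately have "((\<lambda>x. f (\<gamma> x)) \<longlongrightarrow> (\<Sum>n. c n * (w - z) ^ n)) (at_left 1)"
    by (rule Lim_transform_eventually)
  moreover have "((\<lambda>x. f (\<gamma> x)) \<longlongrightarrow> f w) (at_left 1)"
  proof -
    have "isCont f w"
      using holomorphic_on_imp_continuous_on[OF holo] assms by (simp add: continuous_on_eq_continuous_at)
    moreover have "(\<gamma> \<longlongrightarrow> \<gamma> 1) (at_left 1)"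
      unfolding \<gamma>_def by (intro tendsto_intros)
    ultimately show ?thesis by (auto simp: \<gamma>_def intro: isCont_tendsto_compose)
  qed
  ultimately have "(\<Sum>n. c n * (w - z) ^ n) = f w"
    by (intro tendsto_unique[OF trivial_limit_at_left_real])
  then show ?thesis
    using summable by (simp add: c_def sums_iff)
qed

text \<open>If some coefficient differed, the difference series would have an isolated zero at 0,
  yet it sums to 0 throughout the disc.\<close>

lemma powser_coeffs_unique:
  fixes a b :: "nat \<Rightarrow> 'a::{real_normed_field,banach}"
  assumes r: "r > 0"
    and a: "\<And>x. norm x < r \<Longrightarrow> (\<lambda>n. a n * x ^ n) sums f x"
    and b: "\<And>x. norm x < r \<Longrightarrow> (\<lambda>n. b n * x ^ n) sums f x"
  shows "a = b"
proof (rule ccontr)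
  assume "a \<noteq> b"
  then obtain m where m: "a m - b m \<noteq> 0" by (auto simp: fun_eq_iff)
  have sums: "(\<lambda>n. (a n - b n) * x ^ n) sums 0" if "norm x < r" for x
    using sums_diff[OF a[OF that] b[OF that]] by (simp add: left_diff_distrib)
  \<comment> \<open>At \<open>x = 0\<close> only the constant term survives, so the differing
    coefficient has positive index, as the isolation result requires.\<close>
  have "m > 0"
    using sums[of 0] r m by (cases m) (auto simp: powser_sums_zero_iff)
  obtain s where s: "0 < s" "\<And>z::'a. z \<in> cball 0 s - {0} \<Longrightarrow> (0::'a) \<noteq> 0"
    by (rule powser_0_nonzero[where a = "\<lambda>n. a n - b n" and f = "\<lambda>_. 0" and \<xi> = "0::'a" and r = r and m = m])
       (use sums r m \<open>m > 0\<close> in auto)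
  have "of_real s \<in> cball (0::'a) s - {0}" using s(1) by simp
  from s(2)[OF this] show False by simp
qed

section \<open>Derivatives of the stretched exponential\<close>

text \<open>The Gamma quotient is the falling factorial of \<open>\<alpha> * m\<close> with
  \<open>n\<close> factors, produced by differentiating \<open>z powr (\<alpha> * m)\<close>
  \<open>n\<close> times. With \<open>rGamma\<close> it correctly becomes 0 at the poles of
  Gamma.\<close>

definition stretched_exp_coeff :: "real \<Rightarrow> real \<Rightarrow> nat \<Rightarrow> nat \<Rightarrow> real" where
  "stretched_exp_coeff \<alpha> t n m =
     (- t) ^ m / fact m * (Gamma (1 + \<alpha> * real m) * rGamma (1 - real n + \<alpha> * real m))"

text \<open>The \<open>n\<close>-th derivative of \<open>exp (- t * z powr \<alpha>)\<close>. Factoring out \<open>z ^ n\<close> leaves an entire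
  power series in \<open>z powr \<alpha>\<close>, which makes termwise differentiation available.\<close>

definition stretched_exp_deriv :: "real \<Rightarrow> real \<Rightarrow> nat \<Rightarrow> complex \<Rightarrow> complex" where
  "stretched_exp_deriv \<alpha> t n z =
     (\<Sum>m. of_real (stretched_exp_coeff \<alpha> t n m) * (z powr of_real \<alpha>) ^ m) / z ^ n"

lemma stretched_exp_coeff_0:
  assumes "\<alpha> > 0"
  shows "stretched_exp_coeff \<alpha> t 0 m = (- t) ^ m / fact m"
proof -
  have "1 + \<alpha> * real m > 0" using assms by (simp add: add_pos_nonneg)
  then have "Gamma (1 + \<alpha> * real m) * rGamma (1 + \<alpha> * real m) = 1"
    using Gamma_real_pos[of "1 + \<alpha> * real m"]
    by (simp add: rGamma_inverse_Gamma less_imp_neq[symmetric])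
  then show ?thesis by (simp add: stretched_exp_coeff_def)
qed

text \<open>The recurrence \<open>z * rGamma (z + 1) = rGamma z\<close> holds at the poles of Gamma
  too, so no case distinction arises.\<close>

lemma stretched_exp_coeff_Suc:
  "stretched_exp_coeff \<alpha> t (Suc n) m = (\<alpha> * real m - real n) * stretched_exp_coeff \<alpha> t n m"
  using rGamma_plus1[of "\<alpha> * real m - real n"]
  by (simp add: stretched_exp_coeff_def algebra_simps)

lemma sums_stretched_exp_coeff_0:
  fixes v :: complex
  assumes "\<alpha> > 0"
  shows "(\<lambda>m. of_real (stretched_exp_coeff \<alpha> t 0 m) * v ^ m) sums exp (- of_real t * v)"
proof -
  have "(\<lambda>m. (- of_real t * v) ^ m /\<^sub>R fact m) sums exp (- of_real t * v)"
    by (rule exp_converges)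
  also have "(\<lambda>m. (- of_real t * v) ^ m /\<^sub>R fact m) =
      (\<lambda>m. of_real (stretched_exp_coeff \<alpha> t 0 m) * v ^ m)"
    unfolding stretched_exp_coeff_0[OF assms] power_mult_distrib
    by (simp add: scaleR_conv_of_real divide_inverse mult_ac)
  finally show ?thesis .
qed

text \<open>By the recurrence in \<open>n\<close>, the next series combines the current one with
  \<open>v\<close> times its formal derivative, and termwise differentiation preserves convergence
  everywhere. In particular the Wright series used below converge.\<close>

lemma summable_stretched_exp_coeff:
  fixes v :: complex
  assumes "\<alpha> > 0"
  shows "summable (\<lambda>m. of_real (stretched_exp_coeff \<alpha> t n m) * v ^ m)"
proof (induction n arbitrary: v)
  case 0
  show ?case
    using sums_stretched_exp_coeff_0[OF assms] by (rule sums_summable)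
next
  case (Suc n)
  let ?c = "\<lambda>m. complex_of_real (stretched_exp_coeff \<alpha> t n m)"
  have "summable (\<lambda>m. diffs ?c m * v ^ m)"
    by (rule termdiff_converges_all) (rule Suc.IH)
  then have "summable (\<lambda>m. v * (diffs ?c m * v ^ m))" by (rule summable_mult)
  then have "summable (\<lambda>m. of_nat (Suc m) * ?c (Suc m) * v ^ Suc m)"
    by (simp add: diffs_def mult_ac)
  then have "summable (\<lambda>m. of_nat m * ?c m * v ^ m)" by (subst (asm) summable_Suc_iff)
  then have "summable (\<lambda>m. of_real \<alpha> * (of_nat m * ?c m * v ^ m) - of_nat n * (?c m * v ^ m))"
    by (intro summable_diff summable_mult Suc.IH)
  then show ?case
    by (simp add: stretched_exp_coeff_Suc algebra_simps)
qed

lemma stretched_exp_deriv_0: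
  assumes "\<alpha> > 0"
  shows "stretched_exp_deriv \<alpha> t 0 z = exp (- of_real t * z powr of_real \<alpha>)"
  using sums_stretched_exp_coeff_0[OF assms]
  by (simp add: stretched_exp_deriv_def sums_iff)

text \<open>With \<open>v = z powr \<alpha>\<close>, the quotient rule for
  \<open>H v / z ^ n\<close> gives the numerator \<open>\<alpha> * v * H' v - n * H v\<close> over
  \<open>z ^ Suc n\<close>. As \<open>v * H' v\<close> multiplies the \<open>m\<close>-th
  coefficient by \<open>m\<close>, this is the coefficient recurrence.\<close>

lemma has_field_derivative_stretched_exp_deriv:
  assumes "\<alpha> > 0" and z: "Re z > 0"
  shows "(stretched_exp_deriv \<alpha> t n has_field_derivative stretched_exp_deriv \<alpha> t (Suc n) z) (at z)"
proof -
  let ?c = "\<lambda>m. complex_of_real (stretched_exp_coeff \<alpha> t n m)"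
  define H where "H = (\<lambda>v. \<Sum>m. ?c m * v ^ m)"
  define H' where "H' = (\<lambda>v. \<Sum>m. diffs ?c m * v ^ m)"
  have z0: "z \<noteq> 0" and znr: "z \<notin> \<real>\<^sub>\<le>\<^sub>0"
    using z by (auto simp: complex_nonpos_Reals_iff)
  have sum: "summable (\<lambda>m. ?c m * v ^ m)" for v
    by (rule summable_stretched_exp_coeff) fact
  have dH: "(H has_field_derivative H' v) (at v)" for v
    unfolding H_def H'_def by (rule termdiffs_strong_converges_everywhere) (rule sum)
  let ?v = "z powr of_real \<alpha>"
  have vH': "(\<lambda>m. of_nat m * ?c m * v ^ m) sums (v * H' v)" for v
  proof -
    have "(\<lambda>m. diffs ?c m * v ^ m) sums H' v"
      unfolding H'_def by (intro summable_sums termdiff_converges_all sum)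
    from sums_mult[OF this, of v]
    have "(\<lambda>m. of_nat (Suc m) * ?c (Suc m) * v ^ Suc m) sums (v * H' v)"
      by (simp add: diffs_def mult_ac)
    then show ?thesis by (subst (asm) sums_Suc_iff) simp
  qed
  have next_H: "(\<Sum>m. of_real (stretched_exp_coeff \<alpha> t (Suc n) m) * v ^ m)
      = of_real \<alpha> * (v * H' v) - of_nat n * H v" for v
  proof -
    have "(\<lambda>m. of_real \<alpha> * (of_nat m * ?c m * v ^ m) - of_nat n * (?c m * v ^ m)) sums
        (of_real \<alpha> * (v * H' v) - of_nat n * H v)"
      unfolding H_def by (intro sums_diff sums_mult vH' summable_sums sum)
    then show ?thesis
      by (simp add: stretched_exp_coeff_Suc algebra_simps sums_iff)
  qed
  have powr1: "z powr (of_real \<alpha> - 1) = ?v / z"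
    using z0 by (simp add: powr_diff)
  have "((\<lambda>z. H (z powr of_real \<alpha>) / z ^ n) has_field_derivative
      (H' ?v * (of_real \<alpha> * z powr (of_real \<alpha> - 1)) * z ^ n - H ?v * (of_nat n * z ^ (n - 1))) / (z ^ n * z ^ n)) (at z)"
    using z0 znr
    by (auto intro!: derivative_eq_intros DERIV_chain2[OF dH] has_field_derivative_powr)
  also have "(H' ?v * (of_real \<alpha> * z powr (of_real \<alpha> - 1)) * z ^ n - H ?v * (of_nat n * z ^ (n - 1))) / (z ^ n * z ^ n)
      = (of_real \<alpha> * (?v * H' ?v) - of_nat n * H ?v) / z ^ Suc n"
    \<comment> \<open>Splitting on \<open>n\<close> resolves the truncated exponent
      \<open>n - 1\<close>.\<close>
    using z0 unfolding powr1 by (cases n) (simp_all add: field_simps)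
  also have "(\<lambda>z. H (z powr of_real \<alpha>) / z ^ n) = stretched_exp_deriv \<alpha> t n"
    by (simp add: fun_eq_iff H_def stretched_exp_deriv_def)
  also have "(of_real \<alpha> * (?v * H' ?v) - of_nat n * H ?v) / z ^ Suc n = stretched_exp_deriv \<alpha> t (Suc n) z"
    by (simp only: next_H stretched_exp_deriv_def)
  finally show ?thesis .
qed

lemma holomorphic_stretched_exp_deriv:
  assumes "\<alpha> > 0"
  shows "stretched_exp_deriv \<alpha> t n holomorphic_on {z. Re z > 0}"
  using has_field_derivative_stretched_exp_deriv[OF assms]
  by (auto simp: holomorphic_on_open open_halfspace_Re_gt)

lemma higher_deriv_stretched_exp_deriv:
  assumes "\<alpha> > 0" "Re z > 0"
  shows "(deriv ^^ i) (stretched_exp_deriv \<alpha> t n) z = stretched_exp_deriv \<alpha> t (n + i) z"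
  using assms(2)
proof (induction i arbitrary: z)
  case (Suc i)
  \<comment> \<open>Differentiating the induction hypothesis requires it in a whole neighbourhood of
    \<open>z\<close>.\<close>
  have "\<forall>\<^sub>F w in nhds z. Re w > 0"
    using Suc.prems eventually_nhds_in_open[OF open_halfspace_Re_gt, of z 0] by simp
  then have "\<forall>\<^sub>F w in nhds z. (deriv ^^ i) (stretched_exp_deriv \<alpha> t n) w = stretched_exp_deriv \<alpha> t (n + i) w"
    by eventually_elim (rule Suc.IH)
  then have "deriv ((deriv ^^ i) (stretched_exp_deriv \<alpha> t n)) z = deriv (stretched_exp_deriv \<alpha> t (n + i)) z"
    by (rule deriv_cong_ev) simp
  then show ?case
    using has_field_derivative_stretched_exp_deriv[OF assms(1) Suc.prems, of t "n + i"]
    by (simp add: DERIV_imp_deriv)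
qed simp

text \<open>On the positive axis \<open>z powr \<alpha>\<close> is real, and
  \<open>(- t) ^ m\<close> merges with the powers of \<open>x powr \<alpha>\<close> into the Wright
  argument. This is the bridge between derivatives and Wright functions.\<close>

lemma stretched_exp_deriv_of_real:
  assumes "\<alpha> > 0" "x > 0"
  shows "stretched_exp_deriv \<alpha> t n (of_real x) =
    of_real (wright_1psi1 (- (x powr \<alpha>) * t) (1, \<alpha>) (1 - real n, \<alpha>) / x ^ n)"
proof -
  let ?d = "\<lambda>m. stretched_exp_coeff \<alpha> t n m * (x powr \<alpha>) ^ m"
  have "summable (\<lambda>m. of_real (stretched_exp_coeff \<alpha> t n m) * (of_real (x powr \<alpha>) :: complex) ^ m)"
    by (rule summable_stretched_exp_coeff) fact
  then have "summable (\<lambda>m. complex_of_real (?d m))" by simp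
  then have "summable ?d" by (subst (asm) summable_complex_of_real)
  then have "(\<Sum>m. complex_of_real (?d m)) = of_real (\<Sum>m. ?d m)"
    by (simp add: suminf_of_real)
  moreover have "?d m = (- (x powr \<alpha>) * t) ^ m / fact m *
     (Gamma (1 + \<alpha> * real m) * rGamma (1 - real n + \<alpha> * real m))" for m
    by (simp add: stretched_exp_coeff_def mult_ac flip: power_mult_distrib)
  then have "(\<Sum>m. ?d m) = wright_1psi1 (- (x powr \<alpha>) * t) (1, \<alpha>) (1 - real n, \<alpha>)"
    unfolding wright_1psi1_def by simp
  ultimately show ?thesis
    using assms by (simp add: stretched_exp_deriv_def powr_of_real)
qed

section \<open>Poisson processes at an independent random time\<close>

text \<open>Split by the value of \<open>J\<close>: on \<open>J = j\<close> the event is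
  \<open>B j\<close>, the hypothesis factors each piece, and the sum reassembles to an expectation.
  Countability of the index replaces any joint measurability.\<close>

lemma (in prob_space) prob_at_countable_random_index:
  fixes J :: "'a \<Rightarrow> nat"
  assumes [measurable]: "J \<in> measurable M (count_space UNIV)" "\<And>j. B j \<in> events"
    and indep: "\<And>j. prob ({\<omega> \<in> space M. J \<omega> = j} \<inter> B j) = prob {\<omega> \<in> space M. J \<omega> = j} * prob (B j)"
  shows "prob {\<omega> \<in> space M. \<omega> \<in> B (J \<omega>)} = expectation (\<lambda>\<omega>. prob (B (J \<omega>)))"
proof -
  let ?J = "\<lambda>j. {\<omega> \<in> space M. J \<omega> = j}"
  have [measurable]: "?J j \<in> events" for j by measurable
  have "{\<omega> \<in> space M. \<omega> \<in> B (J \<omega>)} = (\<Union>j. ?J j \<inter> B j)"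
    by auto
  also have "emeasure M \<dots> = (\<Sum>j. emeasure M (?J j \<inter> B j))"
    by (rule suminf_emeasure[symmetric]) (auto simp: disjoint_family_on_def)
  also have "\<dots> = (\<Sum>j. ennreal (prob (B j)) * emeasure M (?J j))"
    by (simp add: emeasure_eq_measure indep ennreal_mult mult.commute)
  also have "\<dots> = (\<Sum>j. \<integral>\<^sup>+\<omega>. ennreal (prob (B j)) * indicator (?J j) \<omega> \<partial>M)"
    by (simp add: nn_integral_cmult_indicator)
  also have "\<dots> = (\<integral>\<^sup>+\<omega>. (\<Sum>j. ennreal (prob (B j)) * indicator (?J j) \<omega>) \<partial>M)"
    by (rule nn_integral_suminf[symmetric]) measurable
  also have "\<dots> = (\<integral>\<^sup>+\<omega>. ennreal (prob (B (J \<omega>))) \<partial>M)"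
  proof (rule nn_integral_cong)
    fix \<omega> assume "\<omega> \<in> space M"
    then have "(\<lambda>j. ennreal (prob (B j)) * indicator (?J j) \<omega>) = (\<lambda>j. if j = J \<omega> then ennreal (prob (B j)) else 0)"
      by (auto simp: fun_eq_iff indicator_def)
    then show "(\<Sum>j. ennreal (prob (B j)) * indicator (?J j) \<omega>) = ennreal (prob (B (J \<omega>)))"
      using sums_unique[OF sums_single[of "J \<omega>" "\<lambda>j. ennreal (prob (B j))"]] by simp
  qed
  also have "\<dots> = ennreal (expectation (\<lambda>\<omega>. prob (B (J \<omega>))))"
  proof (rule nn_integral_eq_integral)
    have "(\<lambda>\<omega>. prob (B (J \<omega>))) \<in> borel_measurable M"
      by (rule measurable_compose[OF assms(1)]) simp
    then show "integrable M (\<lambda>\<omega>. prob (B (J \<omega>)))"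
      by (rule integrable_const_bound[where B = 1, rotated]) auto
  qed auto
  finally show ?thesis
    by (simp add: emeasure_eq_measure integral_nonneg_AE)
qed

text \<open>Dyadic approximation strictly from above, so that right-continuity of the Poisson paths
  applies and the approximating times are positive, where the Poisson law is specified.\<close>

definition dyadic_index :: "nat \<Rightarrow> real \<Rightarrow> nat" where
  "dyadic_index n x = Suc (nat \<lfloor>2 ^ n * x\<rfloor>)"

lemma dyadic_index_bounds:
  assumes "x \<ge> 0"
  shows "x < real (dyadic_index n x) / 2 ^ n" "real (dyadic_index n x) / 2 ^ n \<le> x + (1 / 2) ^ n"
proof -
  have "real (nat \<lfloor>2 ^ n * x\<rfloor>) = of_int \<lfloor>2 ^ n * x\<rfloor>" using assms by simp
  moreover have "of_int \<lfloor>2 ^ n * x\<rfloor> \<le> 2 ^ n * x" "2 ^ n * x < of_int \<lfloor>2 ^ n * x\<rfloor> + 1"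
    by linarith+
  ultimately show "x < real (dyadic_index n x) / 2 ^ n" "real (dyadic_index n x) / 2 ^ n \<le> x + (1 / 2) ^ n"
    unfolding dyadic_index_def by (simp_all add: field_simps)
qed

lemma dyadic_index_filterlim:
  assumes "x \<ge> 0"
  shows "filterlim (\<lambda>n. real (dyadic_index n x) / 2 ^ n) (at_right x) sequentially"
  unfolding filterlim_at
proof
  have "(\<lambda>n. x + (1 / 2) ^ n) \<longlonglongrightarrow> x + 0"
    by (intro tendsto_intros) auto
  then have "(\<lambda>n. x + (1 / 2) ^ n) \<longlonglongrightarrow> x" by simp
  then show "(\<lambda>n. real (dyadic_index n x) / 2 ^ n) \<longlonglongrightarrow> x"
    by (rule tendsto_sandwich[OF _ _ tendsto_const, rotated 2])
       (simp_all add: dyadic_index_bounds[OF assms] less_imp_le)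
  show "\<forall>\<^sub>F n in sequentially. real (dyadic_index n x) / 2 ^ n \<in> {x<..} \<and> real (dyadic_index n x) / 2 ^ n \<noteq> x"
    using dyadic_index_bounds(1)[OF assms] by (auto simp: less_imp_neq[symmetric])
qed

text \<open>Right-continuity yields convergence of natural numbers, and distinct naturals are at
  distance at least 1.\<close>

lemma eventually_eq_dyadic:
  fixes N :: "real \<Rightarrow> nat"
  assumes "cadlag_path (\<lambda>t. real (N t))" "x \<ge> 0"
  shows "\<forall>\<^sub>F n in sequentially. N (real (dyadic_index n x) / 2 ^ n) = N x"
proof -
  have "((\<lambda>t. real (N t)) \<longlongrightarrow> real (N x)) (at_right x)"
    using assms by (auto simp: cadlag_path_def continuous_within)
  then have "(\<lambda>n. real (N (real (dyadic_index n x) / 2 ^ n))) \<longlonglongrightarrow> real (N x)"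
    by (rule filterlim_compose) (rule dyadic_index_filterlim[OF assms(2)])
  then have "\<forall>\<^sub>F n in sequentially. dist (real (N (real (dyadic_index n x) / 2 ^ n))) (real (N x)) < 1"
    by (rule tendstoD) simp
  then show ?thesis
    by eventually_elim (simp add: dist_real_def)
qed

lemma poisson_process_prob:
  assumes "poisson_process M r N" "r > 0" "s > 0"
  shows "measure M {\<omega> \<in> space M. N s \<omega> = k} = (r * s) ^ k / fact k * exp (- (r * s))"
    and "{\<omega> \<in> space M. N s \<omega> = k} \<in> sets M"
proof -
  have "(\<lambda>\<omega>. real (N s \<omega>)) \<in> borel_measurable M"
    using assms by (simp add: poisson_process_def levy_process_def)
  then have "(\<lambda>\<omega>. real (N s \<omega>)) -` {real k} \<inter> space M \<in> sets M"
    by (rule measurable_sets) simp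
  moreover have eq: "(\<lambda>\<omega>. real (N s \<omega>)) -` {real k} \<inter> space M = {\<omega> \<in> space M. N s \<omega> = k}" for k
    by auto
  ultimately show "{\<omega> \<in> space M. N s \<omega> = k} \<in> sets M" by simp
  \<comment> \<open>The process definition gives measurability of the real-valued version; preimages
    of singletons transfer it to the discrete space.\<close>
  have [measurable]: "N s \<in> measurable M (count_space UNIV)"
  proof (subst measurable_count_space_eq2_countable, intro conjI ballI)
    fix j
    have "(\<lambda>\<omega>. real (N s \<omega>)) -` {real j} \<inter> space M \<in> sets M"
      using \<open>(\<lambda>\<omega>. real (N s \<omega>)) \<in> borel_measurable M\<close> by (rule measurable_sets) simp
    moreover have "(\<lambda>\<omega>. real (N s \<omega>)) -` {real j} \<inter> space M = N s -` {j} \<inter> space M"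
      by auto
    ultimately show "N s -` {j} \<inter> space M \<in> sets M" by simp
  qed auto
  have "measure M {\<omega> \<in> space M. N s \<omega> = k} = measure (distr M (count_space UNIV) (N s)) {k}"
    by (subst measure_distr) (auto intro!: arg_cong[where f = "measure M"])
  also have "\<dots> = pmf (poisson_pmf (r * s)) k"
    using assms by (simp add: poisson_process_def measure_pmf_single)
  finally show "measure M {\<omega> \<in> space M. N s \<omega> = k} = (r * s) ^ k / fact k * exp (- (r * s))"
    using assms by simp
qed

text \<open>At the dyadic approximations of \<open>S t\<close> the random time takes countably many
  values, so independence gives the expectation of the Poisson product \<open>q\<close>. Dominated
  convergence then passes to \<open>S t\<close> on both sides: by right-continuity of the paths on
  the left, by continuity and boundedness of \<open>q\<close> on the right.\<close>

lemma prob_bivariate_subordinated: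
  assumes "prob_space M" "0 < l1" "0 < l2"
    and S: "levy_subordinator M S"
    and N1: "poisson_process M l1 N1"
    and N2: "poisson_process M l2 N2"
    and indep: "independent_processes M [\<lambda>s \<omega>. real (N1 s \<omega>), \<lambda>s \<omega>. real (N2 s \<omega>), S]"
    and "0 \<le> t"
  shows "measure M {\<omega> \<in> space M. bivariate_subordinated N1 N2 S t \<omega> = (k1, k2)} =
      l1 ^ k1 * l2 ^ k2 / (fact k1 * fact k2) *
      integral\<^sup>L M (\<lambda>\<omega>. S t \<omega> ^ (k1 + k2) * exp (- (l1 + l2) * S t \<omega>))"
proof -
  interpret prob_space M by fact
  have [measurable]: "S t \<in> borel_measurable M"
    using S \<open>0 \<le> t\<close> by (simp add: levy_subordinator_def levy_process_def)
  have S0: "0 \<le> S t \<omega>" if "\<omega> \<in> space M" for \<omega>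
    using S \<open>0 \<le> t\<close> that by (auto simp: levy_subordinator_def)
  define q where "q = (\<lambda>s. ((l1 * s) ^ k1 / fact k1 * exp (- (l1 * s))) * ((l2 * s) ^ k2 / fact k2 * exp (- (l2 * s))))"
  define T where "T = (\<lambda>n j. real j / 2 ^ n :: real)"
  define J where "J = (\<lambda>n \<omega>. dyadic_index n (S t \<omega>))"
  \<comment> \<open>\<open>dyadic_index\<close> is never 0, so events are indexed by its
    predecessor: \<open>Suc j\<close> keeps the time positive for every \<open>j\<close>.\<close>
  define B where "B = (\<lambda>n j. {\<omega> \<in> space M. N1 (T n (Suc j)) \<omega> = k1} \<inter> {\<omega> \<in> space M. N2 (T n (Suc j)) \<omega> = k2})"
  have J_meas [measurable]: "J n \<in> measurable M (count_space UNIV)" for n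
    unfolding J_def dyadic_index_def by measurable
  define A where "A = (\<lambda>n. {\<omega> \<in> space M. \<omega> \<in> B n (J n \<omega> - 1)})"
  have T_pos: "T n (Suc j) > 0" for n j by (simp add: T_def)
  have B_meas [measurable]: "B n j \<in> events" for n j
    unfolding B_def using poisson_process_prob(2)[OF N1] poisson_process_prob(2)[OF N2] assms T_pos
    by (intro sets.Int) auto
  let ?Xs = "[\<lambda>s \<omega>. real (N1 s \<omega>), \<lambda>s \<omega>. real (N2 s \<omega>), S]"
  have indep_sets: "indep_sets (\<lambda>j. process_events M (?Xs ! j)) {..<3}"
    using indep by (simp add: independent_processes_def eval_nat_numeral)
  have ev: "X s -` C \<inter> space M \<in> process_events M X" if "s \<ge> 0" "C \<in> sets borel" for X s C
    unfolding process_events_def using that by (intro sigma_sets.Basic) auto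
  have ev1: "{\<omega> \<in> space M. N1 (T n (Suc j)) \<omega> = k1} \<in> process_events M (?Xs ! 0)" for n j
  proof -
    have "{\<omega> \<in> space M. N1 (T n (Suc j)) \<omega> = k1} = (?Xs ! 0) (T n (Suc j)) -` {real k1} \<inter> space M"
      by auto
    then show ?thesis using ev[of "T n (Suc j)" "{real k1}" "?Xs ! 0"] T_pos by (simp add: less_imp_le)
  qed
  have ev2: "{\<omega> \<in> space M. N2 (T n (Suc j)) \<omega> = k2} \<in> process_events M (?Xs ! 1)" for n j
  proof -
    have "{\<omega> \<in> space M. N2 (T n (Suc j)) \<omega> = k2} = (?Xs ! 1) (T n (Suc j)) -` {real k2} \<inter> space M"
      by auto
    then show ?thesis using ev[of "T n (Suc j)" "{real k2}" "?Xs ! 1"] T_pos by (simp add: less_imp_le)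
  qed
  have ev3: "{\<omega> \<in> space M. J n \<omega> - 1 = j} \<in> process_events M (?Xs ! 2)" for n j
  proof -
    let ?C = "{x. dyadic_index n x - 1 = j}"
    have "(\<lambda>x. dyadic_index n x - 1) \<in> measurable borel (count_space UNIV)"
      unfolding dyadic_index_def by measurable
    then have "?C \<in> sets borel"
      using measurable_sets[of "\<lambda>x. dyadic_index n x - 1" borel "count_space UNIV" "{j}"]
      by (simp add: vimage_def)
    moreover have "{\<omega> \<in> space M. J n \<omega> - 1 = j} = (?Xs ! 2) t -` ?C \<inter> space M"
      by (auto simp: J_def)
    ultimately show ?thesis using ev[of t ?C "?Xs ! 2"] \<open>0 \<le> t\<close> by simp
  qed
  have prob_B: "prob (B n j) = q (T n (Suc j))"
    and prob_JB: "prob ({\<omega> \<in> space M. J n \<omega> - 1 = j} \<inter> B n j) =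
      prob {\<omega> \<in> space M. J n \<omega> - 1 = j} * prob (B n j)" for n j
  proof -
    \<comment> \<open>One event per process: independence over \<open>{0, 1}\<close> factors
      \<open>B n j\<close>, and over \<open>{0, 1, 2}\<close> it separates \<open>B n j\<close> from
      the random index.\<close>
    let ?E = "\<lambda>i::nat. if i = 0 then {\<omega> \<in> space M. N1 (T n (Suc j)) \<omega> = k1}
      else if i = 1 then {\<omega> \<in> space M. N2 (T n (Suc j)) \<omega> = k2}
      else {\<omega> \<in> space M. J n \<omega> - 1 = j}"
    have E: "\<forall>i\<in>I. ?E i \<in> process_events M (?Xs ! i)" if "I \<subseteq> {0, 1, 2}" for I
    proof
      fix i assume "i \<in> I"
      then have "i = 0 \<or> i = 1 \<or> i = 2" using that by auto
      then show "?E i \<in> process_events M (?Xs ! i)"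
        using ev1 ev2 ev3 by (elim disjE) simp_all
    qed
    have "prob (\<Inter>i\<in>{0, 1}. ?E i) = (\<Prod>i\<in>{0, 1}. prob (?E i))"
      by (rule indep_setsD[OF indep_sets _ _ _ E]) auto
    then have *: "prob (B n j) = prob {\<omega> \<in> space M. N1 (T n (Suc j)) \<omega> = k1} * prob {\<omega> \<in> space M. N2 (T n (Suc j)) \<omega> = k2}"
      by (simp add: B_def Int_commute)
    then show "prob (B n j) = q (T n (Suc j))"
      using poisson_process_prob(1)[OF N1] poisson_process_prob(1)[OF N2] assms T_pos
      by (simp add: q_def)
    have "prob (\<Inter>i\<in>{0, 1, 2}. ?E i) = (\<Prod>i\<in>{0, 1, 2}. prob (?E i))"
      by (rule indep_setsD[OF indep_sets _ _ _ E]) auto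
    with * show "prob ({\<omega> \<in> space M. J n \<omega> - 1 = j} \<inter> B n j) =
      prob {\<omega> \<in> space M. J n \<omega> - 1 = j} * prob (B n j)"
      by (simp add: B_def Int_ac mult_ac)
  qed
  have q_eq: "q s = l1 ^ k1 * l2 ^ k2 / (fact k1 * fact k2) * (s ^ (k1 + k2) * exp (- (l1 + l2) * s))" for s
    by (simp add: q_def power_mult_distrib power_add exp_add[symmetric] field_simps flip: exp_add)
  have prob_A: "prob (A n) = expectation (\<lambda>\<omega>. q (T n (J n \<omega>)))" for n
  proof -
    have "prob (A n) = expectation (\<lambda>\<omega>. prob (B n (J n \<omega> - 1)))"
      unfolding A_def by (rule prob_at_countable_random_index[OF _ B_meas prob_JB]) measurable
    also have "\<dots> = expectation (\<lambda>\<omega>. q (T n (J n \<omega>)))"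
      by (simp add: prob_B J_def dyadic_index_def)
    finally show ?thesis .
  qed
  let ?A = "{\<omega> \<in> space M. bivariate_subordinated N1 N2 S t \<omega> = (k1, k2)}"
  have conv: "(\<lambda>n. indicator (A n) \<omega> :: real) \<longlonglongrightarrow> indicator ?A \<omega>" if "\<omega> \<in> space M" for \<omega>
  proof -
    have "cadlag_path (\<lambda>t. real (N1 t \<omega>))" "cadlag_path (\<lambda>t. real (N2 t \<omega>))"
      using N1 N2 that by (auto simp: poisson_process_def levy_process_def)
    note this[THEN eventually_eq_dyadic, OF S0[OF that]]
    then have "\<forall>\<^sub>F n in sequentially. indicator (A n) \<omega> = (indicator ?A \<omega> :: real)"
    proof eventually_elim
      case (elim n)
      have "Suc (J n \<omega> - 1) = J n \<omega>" by (simp add: J_def dyadic_index_def)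
      then show ?case using elim that
        by (simp add: A_def B_def T_def J_def bivariate_subordinated_def indicator_def)
    qed
    then show ?thesis by (rule tendsto_eventually)
  qed
  have [measurable]: "A n \<in> events" for n
  proof -
    have "A n = (\<Union>j. {\<omega> \<in> space M. J n \<omega> - 1 = j} \<inter> B n j)"
      by (auto simp: A_def)
    also have "\<dots> \<in> events" by measurable
    finally show ?thesis .
  qed
  \<comment> \<open>Measurability of the event at the random time is itself obtained from the limit
    of indicators.\<close>
  have "(\<lambda>\<omega>. indicator ?A \<omega> :: real) \<in> borel_measurable M"
    by (rule borel_measurable_LIMSEQ_real[OF conv]) auto
  then have A_meas [measurable]: "?A \<in> events"
    by (subst (asm) borel_measurable_indicator_iff) (simp add: Int_absorb2)
  have "(\<lambda>n. expectation (indicator (A n))) \<longlonglongrightarrow> (expectation (indicator ?A) :: real)"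
    by (rule integral_dominated_convergence[where w = "\<lambda>_. 1"]) (use conv in auto)
  then have lim1: "(\<lambda>n. prob (A n)) \<longlonglongrightarrow> prob ?A" by simp
  \<comment> \<open>For \<open>s > 0\<close>, \<open>q s\<close> is a product of two probabilities;
    all approximating times are positive.\<close>
  have q_bound: "norm (q s) \<le> 1" if "s > 0" for s
  proof -
    have "measure M {\<omega> \<in> space M. N1 s \<omega> = k1} * measure M {\<omega> \<in> space M. N2 s \<omega> = k2} \<le> 1 * 1"
      by (intro mult_mono) auto
    moreover have "q s = measure M {\<omega> \<in> space M. N1 s \<omega> = k1} * measure M {\<omega> \<in> space M. N2 s \<omega> = k2}"
      using poisson_process_prob(1)[OF N1] poisson_process_prob(1)[OF N2] assms that
      by (simp add: q_def)
    ultimately show ?thesis by simp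
  qed
  have q_cont: "isCont q s" for s unfolding q_def by (intro continuous_intros) auto
  have [measurable]: "q \<in> borel_measurable borel" unfolding q_def by measurable
  have "(\<lambda>n. expectation (\<lambda>\<omega>. q (T n (J n \<omega>)))) \<longlonglongrightarrow> expectation (\<lambda>\<omega>. q (S t \<omega>))"
  proof (rule integral_dominated_convergence[where w = "\<lambda>_. 1"])
    show "(\<lambda>\<omega>. q (T n (J n \<omega>))) \<in> borel_measurable M" for n
      by (rule measurable_compose[OF J_meas]) simp
    show "AE \<omega> in M. (\<lambda>n. q (T n (J n \<omega>))) \<longlonglongrightarrow> q (S t \<omega>)"
    proof (rule AE_I2)
      fix \<omega> assume "\<omega> \<in> space M"
      from dyadic_index_filterlim[OF S0[OF this]]
      have "(\<lambda>n. T n (J n \<omega>)) \<longlonglongrightarrow> S t \<omega>"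
        by (simp add: filterlim_at T_def J_def)
      then show "(\<lambda>n. q (T n (J n \<omega>))) \<longlonglongrightarrow> q (S t \<omega>)"
        by (rule isCont_tendsto_compose[OF q_cont])
    qed
    show "AE \<omega> in M. norm (q (T n (J n \<omega>))) \<le> 1" for n
      by (rule AE_I2, rule q_bound) (simp add: T_def J_def dyadic_index_def)
  qed auto
  with lim1 have "prob ?A = expectation (\<lambda>\<omega>. q (S t \<omega>))"
    unfolding prob_A by (rule LIMSEQ_unique)
  then show ?thesis by (simp add: q_eq)
qed

section \<open>Moments of the tempered stable subordinator\<close>

text \<open>Expand \<open>exp (- x * X)\<close> and integrate termwise. The absolute values of the
  terms sum to \<open>exp (- (L - \<bar>x\<bar>) * X)\<close>, which is at most 1 because
  \<open>\<bar>x\<bar> < L\<close> and \<open>X\<close> is nonnegative.\<close>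

lemma (in prob_space) laplace_transform_power_series:
  fixes X :: "'a \<Rightarrow> real"
  assumes [measurable]: "X \<in> borel_measurable M"
    and X0: "\<And>\<omega>. \<omega> \<in> space M \<Longrightarrow> 0 \<le> X \<omega>"
    and x: "\<bar>x\<bar> < L"
  shows "(\<lambda>k. (- 1) ^ k * expectation (\<lambda>\<omega>. X \<omega> ^ k * exp (- L * X \<omega>)) / fact k * x ^ k) sums
    expectation (\<lambda>\<omega>. exp (- (L + x) * X \<omega>))"
proof -
  have L: "L > 0" using x by simp
  let ?f = "\<lambda>k \<omega>. (- x * X \<omega>) ^ k /\<^sub>R fact k * exp (- L * X \<omega>)"
  have f_sums: "(\<lambda>k. ?f k \<omega>) sums exp (- (L + x) * X \<omega>)" for \<omega>
    using sums_mult2[OF exp_converges[of "- x * X \<omega>"], of "exp (- L * X \<omega>)"]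
    by (simp add: exp_add[symmetric] algebra_simps flip: exp_add)
  have norm_f: "norm (?f k \<omega>) = (\<bar>x\<bar> * X \<omega>) ^ k /\<^sub>R fact k * exp (- L * X \<omega>)" if "\<omega> \<in> space M" for k \<omega>
    using X0[OF that] by (simp add: abs_mult power_abs)
  have norm_sums: "(\<lambda>k. norm (?f k \<omega>)) sums exp (- (L - \<bar>x\<bar>) * X \<omega>)" if "\<omega> \<in> space M" for \<omega>
    using sums_mult2[OF exp_converges[of "\<bar>x\<bar> * X \<omega>"], of "exp (- L * X \<omega>)"]
    unfolding norm_f[OF that] by (simp add: algebra_simps flip: exp_add)
  have int: "integrable M (\<lambda>\<omega>. norm (?f k \<omega>))" for k
  proof (rule integrable_const_bound[where B = 1])
    show "AE \<omega> in M. norm (norm (?f k \<omega>)) \<le> 1"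
    proof (rule AE_I2)
      fix \<omega> assume \<omega>: "\<omega> \<in> space M"
      have "norm (?f k \<omega>) \<le> exp (- (L - \<bar>x\<bar>) * X \<omega>)"
        using sum_le_suminf[OF sums_summable[OF norm_sums[OF \<omega>]], of "{k}"] norm_sums[OF \<omega>]
        by (simp add: sums_iff)
      also have "\<dots> \<le> 1" using x X0[OF \<omega>] by (simp add: mult_nonpos_nonneg)
      finally show "norm (norm (?f k \<omega>)) \<le> 1" by simp
    qed
  qed measurable
  have f_int: "integrable M (?f k)" for k
    by (rule integrable_norm_cancel[OF int]) measurable
  have "(\<lambda>k. integral\<^sup>L M (?f k)) sums expectation (\<lambda>\<omega>. \<Sum>k. ?f k \<omega>)"
  proof (rule sums_integral[OF f_int])
    show "AE \<omega> in M. summable (\<lambda>k. norm (?f k \<omega>))"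
      by (rule AE_I2) (rule sums_summable[OF norm_sums])
    show "summable (\<lambda>k. expectation (\<lambda>\<omega>. norm (?f k \<omega>)))"
    \<comment> \<open>The pointwise bound 1 on partial sums carries over to their
      expectations.\<close>
    proof (rule bounded_imp_summable[where B = 1])
      fix n
      have "(\<Sum>k\<le>n. expectation (\<lambda>\<omega>. norm (?f k \<omega>))) = expectation (\<lambda>\<omega>. \<Sum>k\<le>n. norm (?f k \<omega>))"
        by (rule Bochner_Integration.integral_sum[symmetric]) (rule int)
      also have "\<dots> \<le> expectation (\<lambda>\<omega>. 1)"
      proof (rule integral_mono)
        fix \<omega> assume \<omega>: "\<omega> \<in> space M"
        have "(\<Sum>k\<le>n. norm (?f k \<omega>)) \<le> exp (- (L - \<bar>x\<bar>) * X \<omega>)"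
          using sum_le_suminf[OF sums_summable[OF norm_sums[OF \<omega>]], of "{..n}"] norm_sums[OF \<omega>]
          by (simp add: sums_iff)
        also have "\<dots> \<le> 1" using x X0[OF \<omega>] by (simp add: mult_nonpos_nonneg)
        finally show "(\<Sum>k\<le>n. norm (?f k \<omega>)) \<le> 1" .
      qed (use int in auto)
      finally show "(\<Sum>k\<le>n. expectation (\<lambda>\<omega>. norm (?f k \<omega>))) \<le> 1" by (simp add: prob_space)
    qed auto
  qed
  moreover have "(\<Sum>k. ?f k \<omega>) = exp (- (L + x) * X \<omega>)" for \<omega>
    using f_sums by (simp add: sums_iff)
  moreover have "integral\<^sup>L M (?f k) = (- 1) ^ k * expectation (\<lambda>\<omega>. X \<omega> ^ k * exp (- L * X \<omega>)) / fact k * x ^ k" for k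
  proof -
    have "?f k = (\<lambda>\<omega>. ((- 1) ^ k * x ^ k / fact k) * (X \<omega> ^ k * exp (- L * X \<omega>)))"
      by (simp add: fun_eq_iff power_mult_distrib power_minus[of x] divide_inverse mult_ac power_minus[of "x * X _"])
    then show ?thesis by simp
  qed
  ultimately show ?thesis by simp
qed

text \<open>The Laplace transform at \<open>L + x\<close> has two expansions in \<open>x\<close>:
  one with the moments as coefficients, one from the Taylor series of the stretched exponential at
  \<open>L + \<theta>\<close>. Comparing coefficients identifies the moments.\<close>

lemma tempered_stable_moment:
  assumes "prob_space M" "0 < \<alpha>" "0 < \<theta>" "0 < L" "0 \<le> t"
    and S: "tempered_stable_subordinator M \<alpha> \<theta> S"
  shows "complex_of_real (integral\<^sup>L M (\<lambda>\<omega>. S t \<omega> ^ k * exp (- L * S t \<omega>))) =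
    (- 1) ^ k * exp (of_real (t * \<theta> powr \<alpha>)) * stretched_exp_deriv \<alpha> t k (of_real (L + \<theta>))"
proof -
  interpret prob_space M by fact
  let ?w = "L + \<theta>"
  let ?g = "\<lambda>n x. wright_1psi1 (- (x powr \<alpha>) * t) (1, \<alpha>) (1 - real n, \<alpha>) / x ^ n"
  let ?m = "\<lambda>k. expectation (\<lambda>\<omega>. S t \<omega> ^ k * exp (- L * S t \<omega>))"
  have levy: "levy_subordinator M S"
    using S by (simp add: tempered_stable_subordinator_def)
  have [measurable]: "S t \<in> borel_measurable M"
    using levy \<open>0 \<le> t\<close> by (simp add: levy_subordinator_def levy_process_def)
  have S0: "0 \<le> S t \<omega>" if "\<omega> \<in> space M" for \<omega>
    using levy \<open>0 \<le> t\<close> that by (auto simp: levy_subordinator_def)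
  let ?F = "\<lambda>x. expectation (\<lambda>\<omega>. exp (- (L + x) * S t \<omega>))"
  have "(\<lambda>k. (- 1) ^ k * ?m k / fact k) = (\<lambda>k. exp (t * \<theta> powr \<alpha>) * ?g k ?w / fact k)"
  \<comment> \<open>Radius \<open>L\<close> keeps \<open>L + x\<close> nonnegative, where the
    Laplace transform is prescribed.\<close>
  proof (rule powser_coeffs_unique[where r = L and f = ?F])
    fix x :: real assume "norm x < L"
    then have x: "\<bar>x\<bar> < L" by simp
    show "(\<lambda>k. (- 1) ^ k * ?m k / fact k * x ^ k) sums ?F x"
      by (rule laplace_transform_power_series) (use S0 x in auto)
    let ?G = "stretched_exp_deriv \<alpha> t 0"
    have "(\<lambda>n. (deriv ^^ n) ?G (of_real ?w) / fact n * (of_real (?w + x) - of_real ?w) ^ n)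
        sums ?G (of_real (?w + x))"
    \<comment> \<open>The ball of radius \<open>?w\<close> around \<open>?w\<close> stays in the
      right half-plane and contains \<open>?w + x\<close>, since
      \<open>\<bar>x\<bar> < L < ?w\<close>.\<close>
    proof (rule holomorphic_power_series)
      have "Re z > 0" if "z \<in> ball (of_real ?w) ?w" for z
        using that abs_Re_le_cmod[of "of_real ?w - z"] by (simp add: dist_norm)
      then show "?G holomorphic_on ball (of_real ?w) ?w"
        by (intro holomorphic_on_subset[OF holomorphic_stretched_exp_deriv[OF \<open>0 < \<alpha>\<close>]]) auto
      show "of_real (?w + x) \<in> ball (complex_of_real ?w) ?w"
        using x \<open>0 < \<theta>\<close> by (simp add: dist_norm flip: of_real_add of_real_diff)
    qed
    moreover have "(deriv ^^ n) ?G (of_real ?w) = of_real (?g n ?w)" for n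
      using assms by (subst higher_deriv_stretched_exp_deriv)
        (simp_all add: stretched_exp_deriv_of_real del: of_real_add)
    moreover have "of_real (?w + x) - of_real ?w = complex_of_real x" by simp
    moreover have "?G (of_real (?w + x)) = of_real (exp (- t * (?w + x) powr \<alpha>))"
      using assms x unfolding stretched_exp_deriv_0[OF \<open>0 < \<alpha>\<close>]
      by (subst powr_of_real) (simp_all add: exp_of_real[symmetric])
    ultimately have "(\<lambda>n. complex_of_real (?g n ?w / fact n * x ^ n)) sums
        of_real (exp (- t * (?w + x) powr \<alpha>))"
      by (simp only: of_real_mult of_real_divide of_real_power of_real_fact)
    then have "(\<lambda>n. ?g n ?w / fact n * x ^ n) sums exp (- t * (?w + x) powr \<alpha>)"
      by (simp only: sums_of_real_iff)
    from sums_mult[OF this, of "exp (t * \<theta> powr \<alpha>)"]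
    have "(\<lambda>n. exp (t * \<theta> powr \<alpha>) * ?g n ?w / fact n * x ^ n) sums
        (exp (t * \<theta> powr \<alpha>) * exp (- t * (?w + x) powr \<alpha>))"
      by (simp add: mult_ac)
    also have "exp (t * \<theta> powr \<alpha>) * exp (- t * (?w + x) powr \<alpha>) =
        exp (- t * ((L + x + \<theta>) powr \<alpha> - \<theta> powr \<alpha>))"
      by (simp add: exp_add[symmetric] algebra_simps)
    also have "\<dots> = ?F x"
    proof -
      have "\<forall>u\<ge>0. expectation (\<lambda>\<omega>. exp (- u * S t \<omega>)) =
          exp (- t * ((u + \<theta>) powr \<alpha> - \<theta> powr \<alpha>))"
        using S \<open>0 \<le> t\<close> unfolding tempered_stable_subordinator_def by blast
      moreover have "L + x \<ge> 0" using x by simp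
      ultimately show ?thesis by metis
    qed
    finally show "(\<lambda>n. exp (t * \<theta> powr \<alpha>) * ?g n ?w / fact n * x ^ n) sums ?F x" .
  qed (use assms in auto)
  from fun_cong[OF this, of k]
  have eq: "(- 1) ^ k * ?m k = exp (t * \<theta> powr \<alpha>) * ?g k ?w"
    by (simp only: divide_cancel_right fact_nonzero simp_thms)
  have "?m k = (- 1) ^ k * ((- 1) ^ k * ?m k)"
    by (rule left_minus_one_mult_self[symmetric])
  then have "?m k = (- 1) ^ k * exp (t * \<theta> powr \<alpha>) * ?g k ?w"
    unfolding eq by (simp only: mult.assoc)
  then show ?thesis
    using assms
    by (simp add: stretched_exp_deriv_of_real exp_of_real[symmetric] del: of_real_add)
qed

section \<open>The joint law as a series of Wright functions\<close>

text \<open>\<open>suminf\<close> carries information only for a summable series, so convergence is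
  a separate claim for \<open>\<theta> < l1 + l2\<close>, and the formula is asserted for every
  \<open>\<theta>\<close> at which the outer series converges.\<close>

theorem proposition3p1:
  fixes M :: "'a measure"
    and \<alpha> \<theta> l1 l2 t :: real
    and N1 N2 :: "real \<Rightarrow> 'a \<Rightarrow> nat"
    and S :: "real \<Rightarrow> 'a \<Rightarrow> real"
    and k1 k2 :: nat
  assumes "prob_space M"
    and "0 < \<alpha>" and "\<alpha> < 1" and "0 < \<theta>" and "0 < l1" and "0 < l2"
    and "tempered_stable_subordinator M \<alpha> \<theta> S"
    and "poisson_process M l1 N1"
    and "poisson_process M l2 N2"
    and "independent_processes M [\<lambda>s \<omega>. real (N1 s \<omega>), \<lambda>s \<omega>. real (N2 s \<omega>), S]"
    and "0 \<le> t"
  shows "let a = (\<lambda>i::nat. \<theta> ^ i / (fact i * (l1 + l2) ^ i) *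
                   wright_1psi1 (- ((l1 + l2) powr \<alpha>) * t)
                     (1, \<alpha>) (1 - real (k1 + k2) - real i, \<alpha>))
         in (\<theta> < l1 + l2 \<longrightarrow> summable a) \<and>
            (summable a \<longrightarrow>
               measure M {\<omega> \<in> space M. bivariate_subordinated N1 N2 S t \<omega> = (k1, k2)} =
                 (- 1 / (l1 + l2)) ^ (k1 + k2) * (l1 ^ k1 * l2 ^ k2 / (fact k1 * fact k2)) *
                 exp (t * \<theta> powr \<alpha>) * (\<Sum>i. a i))"
proof -
  define L where "L = l1 + l2"
  define k where "k = k1 + k2"
  define a where "a = (\<lambda>i::nat. \<theta> ^ i / (fact i * L ^ i) *
    wright_1psi1 (- (L powr \<alpha>) * t) (1, \<alpha>) (1 - real k - real i, \<alpha>))"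
  let ?D = "stretched_exp_deriv \<alpha> t k"
  let ?H = "{z. Re z > 0}"
  let ?T = "\<lambda>i. (deriv ^^ i) ?D (of_real L) / fact i * (of_real (L + \<theta>) - of_real L) ^ i"
  have L: "L > 0" using assms by (simp add: L_def)
  \<comment> \<open>The derivative of order \<open>k + i\<close> carries
    \<open>1 / L ^ (k + i)\<close>; the factor \<open>L ^ k\<close> leaves the
    \<open>1 / L ^ i\<close> of the series.\<close>
  have T: "of_real L ^ k * ?T i = of_real (a i)" for i
  proof -
    have "?T i = stretched_exp_deriv \<alpha> t (k + i) (of_real L) / fact i * of_real \<theta> ^ i"
      using assms L by (simp add: higher_deriv_stretched_exp_deriv)
    also have "stretched_exp_deriv \<alpha> t (k + i) (of_real L) =
        of_real (wright_1psi1 (- (L powr \<alpha>) * t) (1, \<alpha>) (1 - real k - real i, \<alpha>) / L ^ (k + i))"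
      using assms L by (simp add: stretched_exp_deriv_of_real diff_diff_eq)
    finally show ?thesis
      using L by (simp add: a_def power_add field_simps)
  qed
  have holo: "?D holomorphic_on ?H"
    using assms by (intro holomorphic_stretched_exp_deriv)
  have summable_T: "summable ?T \<longleftrightarrow> summable a"
  proof -
    have "summable ?T \<longleftrightarrow> summable (\<lambda>i. of_real L ^ k * ?T i)"
      using L by (subst summable_cmult_iff) simp
    then show ?thesis unfolding T by (simp add: summable_complex_of_real)
  qed
  have "summable a" if "\<theta> < L"
  proof -
    have "?T sums ?D (of_real (L + \<theta>))"
    \<comment> \<open>The ball of radius \<open>L\<close> around \<open>L\<close> lies in the
      half-plane and contains \<open>L + \<theta>\<close> because
      \<open>\<theta> < L\<close>.\<close>
    proof (rule holomorphic_power_series)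
      have "Re z > 0" if "z \<in> ball (of_real L) L" for z
        using that abs_Re_le_cmod[of "of_real L - z"] by (simp add: dist_norm)
      then show "?D holomorphic_on ball (of_real L) L"
        by (intro holomorphic_on_subset[OF holo]) auto
      show "of_real (L + \<theta>) \<in> ball (complex_of_real L) L"
        using that assms by (simp add: dist_norm)
    qed
    then show ?thesis using summable_T by (simp add: sums_iff)
  qed
  moreover have "measure M {\<omega> \<in> space M. bivariate_subordinated N1 N2 S t \<omega> = (k1, k2)} =
      (- 1 / L) ^ k * (l1 ^ k1 * l2 ^ k2 / (fact k1 * fact k2)) * exp (t * \<theta> powr \<alpha>) * (\<Sum>i. a i)"
    if "summable a"
  proof -
    have "?T sums ?D (of_real (L + \<theta>))"
    \<comment> \<open>Here \<open>\<theta>\<close> may be \<open>L\<close> or larger: only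
      summability and a convex domain containing \<open>L\<close> and \<open>L + \<theta>\<close>
      enter.\<close>
    proof (rule taylor_sum_eq_if_summable[where U = ?H])
      show "open ?H" "convex ?H"
        by (simp_all add: open_halfspace_Re_gt convex_halfspace_Re_gt)
      show "summable ?T" using that summable_T by simp
    qed (use holo L assms in auto)
    from sums_mult[OF this, of "of_real L ^ k"]
    have "(\<lambda>i. complex_of_real (a i)) sums (of_real L ^ k * ?D (of_real (L + \<theta>)))"
      unfolding T .
    moreover have "(\<lambda>i. complex_of_real (a i)) sums of_real (\<Sum>i. a i)"
      using that by (simp only: sums_of_real_iff summable_sums)
    ultimately have "of_real (\<Sum>i. a i) = of_real L ^ k * ?D (of_real (L + \<theta>))"
      by (rule sums_unique2[symmetric])
    then have D: "?D (of_real (L + \<theta>)) = of_real ((\<Sum>i. a i) / L ^ k)"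
      using L by (simp add: field_simps)
    have "complex_of_real (integral\<^sup>L M (\<lambda>\<omega>. S t \<omega> ^ k * exp (- L * S t \<omega>))) =
        (- 1) ^ k * exp (of_real (t * \<theta> powr \<alpha>)) * ?D (of_real (L + \<theta>))"
      using assms L by (intro tempered_stable_moment) auto
    also have "\<dots> = of_real ((- 1) ^ k * exp (t * \<theta> powr \<alpha>) * ((\<Sum>i. a i) / L ^ k))"
      unfolding D exp_of_real by simp
    finally have "integral\<^sup>L M (\<lambda>\<omega>. S t \<omega> ^ k * exp (- L * S t \<omega>)) =
        (- 1) ^ k * exp (t * \<theta> powr \<alpha>) * ((\<Sum>i. a i) / L ^ k)"
      by (simp only: of_real_eq_iff)
    moreover have "measure M {\<omega> \<in> space M. bivariate_subordinated N1 N2 S t \<omega> = (k1, k2)} =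
        l1 ^ k1 * l2 ^ k2 / (fact k1 * fact k2) *
        integral\<^sup>L M (\<lambda>\<omega>. S t \<omega> ^ k * exp (- L * S t \<omega>))"
      unfolding k_def L_def
      by (rule prob_bivariate_subordinated)
         (use assms in \<open>auto simp: tempered_stable_subordinator_def\<close>)
    \<comment> \<open>The sign of the moment and the \<open>1 / L ^ k\<close> left from rescaling
      combine to \<open>(- 1 / L) ^ k\<close>.\<close>
    ultimately show ?thesis
      by (simp only: power_divide) (simp add: mult_ac)
  qed
  ultimately show ?thesis
    unfolding Let_def a_def L_def k_def by blast
qed

end
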